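(* Let $K$ be a finite simplicial complex and $v$ a vertex of $K$. The one-point suspension $\operatorname{Susp}_1(v,K)$ is constructible if and only if $K$ is constructible.
   Context: Simplicial complexes are finite abstract simplicial complexes; the empty set is a face. A complex is pure if all its maximal faces (facets) have the same dimension. For a vertex $v$ of $K$: $\operatorname{link}_K(v)=\{F\in K: v\notin F,\ \{v\}\cup F\in K\}$ and $\operatorname{star}_K(v)=\{F\in K: v\in F\}$ (a set of faces). For sets of faces $A,B$ on disjoint vertex sets, $A*B=\{F\cup G: F\in A, G\in B\}$. One-point suspension: let $v',v''$ be two new vertices (copies of $v$) not in $K$, let $\overline{v'v''}$ be the edge (full simplex) they span and $\partial\,\overline{v'v''}=\{\emptyset,\{v'\},\{v''\}\}$. Then $$\operatorname{Susp}_1(v,K)=\bigl((\partial\,\overline{v'v''}*K)\setminus(\partial\,\overline{v'v''}*\operatorname{star}_K(v))\bigr)\cup\bigl(\overline{v'v''}*\operatorname{link}_K(v)\bigr).$$ Constructible (recursive definition): a pure $m$-dimensional complex $L$ is constructible if either $L$ is a simplex (possibly $\{\emptyset\}$), or there are two $m$-dimensional constructible subcomplexes $L_1,L_2$ of $L$ with $L_1\cup L_2=L$ such that $L_1\cap L_2$ is an $(m-1)$-dimensional constructible complex. Non-pure complexes are not constructible. *)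

theory Defs
  imports Main
begin

definition simplicial_complex :: "'a set set \<Rightarrow> bool" where
  "simplicial_complex K \<longleftrightarrow>
     finite K \<and> {} \<in> K \<and> (\<forall>F\<in>K. finite F) \<and> (\<forall>F\<in>K. \<forall>G. G \<subseteq> F \<longrightarrow> G \<in> K)"

definition subcomplex :: "'a set set \<Rightarrow> 'a set set \<Rightarrow> bool" where
  "subcomplex L K \<longleftrightarrow> simplicial_complex L \<and> L \<subseteq> K"

definition vertices :: "'a set set \<Rightarrow> 'a set" where
  "vertices K = {v. {v} \<in> K}"

definition facets :: "'a set set \<Rightarrow> 'a set set" where
  "facets K = {F \<in> K. \<forall>G\<in>K. F \<subseteq> G \<longrightarrow> G = F}"

text \<open>Dimensions are integers, since the empty face has dimension \<open>-1\<close>.\<close>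

definition face_dim :: "'a set \<Rightarrow> int" where
  "face_dim F = int (card F) - 1"

definition complex_dim :: "'a set set \<Rightarrow> int" where
  "complex_dim K = Max (face_dim ` K)"

definition pure :: "'a set set \<Rightarrow> bool" where
  "pure K \<longleftrightarrow> (\<forall>F\<in>facets K. \<forall>G\<in>facets K. face_dim F = face_dim G)"

definition link :: "'a set set \<Rightarrow> 'a \<Rightarrow> 'a set set" where
  "link K v = {F \<in> K. v \<notin> F \<and> insert v F \<in> K}"

text \<open>The star is the set of faces containing \<open>v\<close> (the open star), not a subcomplex.\<close>

definition star :: "'a set set \<Rightarrow> 'a \<Rightarrow> 'a set set" where
  "star K v = {F \<in> K. v \<in> F}"

definition join :: "'a set set \<Rightarrow> 'a set set \<Rightarrow> 'a set set" where
  "join A B = {F \<union> G | F G. F \<in> A \<and> G \<in> B}"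

definition edge :: "'a \<Rightarrow> 'a \<Rightarrow> 'a set set" where
  "edge a b = Pow {a, b}"

definition edge_boundary :: "'a \<Rightarrow> 'a \<Rightarrow> 'a set set" where
  "edge_boundary a b = {{}, {a}, {b}}"

text \<open>The arguments \<open>v'\<close> and \<open>v''\<close> are the two copies of \<open>v\<close>; the definition is meaningful when
  they are distinct and are not vertices of \<open>K\<close>. The vertex \<open>v\<close> itself does not survive.\<close>

definition one_point_suspension :: "'a \<Rightarrow> 'a \<Rightarrow> 'a \<Rightarrow> 'a set set \<Rightarrow> 'a set set" where
  "one_point_suspension v' v'' v K =
     (join (edge_boundary v' v'') K - join (edge_boundary v' v'') (star K v))
     \<union> join (edge v' v'') (link K v)"

text \<open>The empty set \<open>F\<close> is allowed in the first rule, so \<open>{{}}\<close> is constructible, of dimension \<open>-1\<close>.\<close>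

inductive constructible :: "'a set set \<Rightarrow> bool" where
  simplex: "finite F \<Longrightarrow> constructible (Pow F)"
| union: "\<lbrakk>simplicial_complex L; pure L;
     subcomplex L1 L; constructible L1; complex_dim L1 = complex_dim L;
     subcomplex L2 L; constructible L2; complex_dim L2 = complex_dim L;
     L1 \<union> L2 = L;
     constructible (L1 \<inter> L2); complex_dim (L1 \<inter> L2) = complex_dim L - 1\<rbrakk>
   \<Longrightarrow> constructible L"

end

theory Submission
  imports Defs "HOL-Combinatorics.Transposition"
begin

text \<open>The one-point suspension commutes with unions and intersections of complexes and turns a
  simplex into a simplex (if it contains \<open>v\<close>) or into two simplices glued along a facet, so a
  decomposition of \<open>K\<close> lifts to one of the suspension. For this induction \<open>v\<close> must not be required
  to be a vertex of \<open>K\<close>. Conversely, links of vertices in constructible complexes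
  are constructible, and the link of \<open>v'\<close> in the suspension is a copy of \<open>K\<close> with \<open>v\<close>
  renamed to \<open>v''\<close>.\<close>

section \<open>Purity and constructibility graded by facet size\<close>

lemma simplicial_complex_mono:
  "\<lbrakk>simplicial_complex K; F \<in> K; G \<subseteq> F\<rbrakk> \<Longrightarrow> G \<in> K"
  unfolding simplicial_complex_def by blast

lemma simplicial_complex_Pow: "finite F \<Longrightarrow> simplicial_complex (Pow F)"
  unfolding simplicial_complex_def by (auto dest: rev_finite_subset)

lemma simplicial_complex_Un:
  "\<lbrakk>simplicial_complex A; simplicial_complex B\<rbrakk> \<Longrightarrow> simplicial_complex (A \<union> B)"
  unfolding simplicial_complex_def by auto

text \<open>The index \<open>d\<close> counts the vertices of a facet, so it is the dimension plus
  one and \<open>{{}}\<close> has \<open>d = 0\<close>. Demanding that each face extend to one with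
  \<open>d\<close> elements gives a form of purity that passes directly to unions, unlike one
  phrased through \<open>facets\<close>.\<close>

definition pure_of_card :: "nat \<Rightarrow> 'a set set \<Rightarrow> bool" where
  "pure_of_card d K \<longleftrightarrow> simplicial_complex K \<and> (\<forall>F\<in>K. card F \<le> d \<and> (\<exists>G\<in>K. F \<subseteq> G \<and> card G = d))"

lemma pure_of_card_complex_dim:
  assumes "pure_of_card d K"
  shows "complex_dim K = int d - 1"
  unfolding complex_dim_def
proof (rule Max_eqI)
  show "finite (face_dim ` K)"
    using assms by (simp add: pure_of_card_def simplicial_complex_def)
  show "n \<le> int d - 1" if "n \<in> face_dim ` K" for n
    using assms that by (auto simp: pure_of_card_def face_dim_def)
  obtain G where "G \<in> K" "card G = d"
    using assms by (auto simp: pure_of_card_def simplicial_complex_def)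
  then show "int d - 1 \<in> face_dim ` K" by (auto simp: face_dim_def intro!: image_eqI[of _ _ G])
qed

lemma pure_of_card_pure:
  assumes "pure_of_card d K"
  shows "pure K"
proof -
  have "card F = d" if "F \<in> facets K" for F
    using assms that by (force simp: pure_of_card_def facets_def)
  then show ?thesis by (simp add: pure_def face_dim_def)
qed

text \<open>\<open>graded_constructible d\<close> is constructibility in dimension \<open>d - 1\<close>: purity of the union is
  automatic once both parts are pure of the same dimension.\<close>

inductive graded_constructible :: "nat \<Rightarrow> 'a set set \<Rightarrow> bool" where
  simplex: "finite F \<Longrightarrow> graded_constructible (card F) (Pow F)"
| union: "\<lbrakk>graded_constructible (Suc d) A; graded_constructible (Suc d) B;
     graded_constructible d (A \<inter> B)\<rbrakk> \<Longrightarrow> graded_constructible (Suc d) (A \<union> B)"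

lemma graded_constructible_pure: "graded_constructible d K \<Longrightarrow> pure_of_card d K"
proof (induction rule: graded_constructible.induct)
  case (simplex F)
  then show ?case
    by (auto simp: pure_of_card_def simplicial_complex_Pow intro: card_mono)
next
  case (union d A B)
  then show ?case
    unfolding pure_of_card_def by (simp add: simplicial_complex_Un) (metis Un_iff)
qed

lemma graded_constructible_complex:
  "graded_constructible d K \<Longrightarrow> simplicial_complex K"
  by (drule graded_constructible_pure) (simp add: pure_of_card_def)

text \<open>Each graded piece has dimension its index minus one, so the dimension conditions of the
  \<open>union\<close> rule say exactly that both parts have index \<open>Suc c\<close> when their
  intersection has index \<open>c\<close>. Conversely, purity and all dimensions can be read off
  from the index.\<close>

lemma constructible_iff_graded: "constructible K \<longleftrightarrow> (\<exists>d. graded_constructible d K)"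
proof
  assume "constructible K"
  then show "\<exists>d. graded_constructible d K"
  proof (induction rule: constructible.induct)
    case (simplex F)
    then show ?case using graded_constructible.simplex by blast
  next
    case (union L A B)
    then obtain a b c where *: "graded_constructible a A" "graded_constructible b B"
      "graded_constructible c (A \<inter> B)" by blast
    note dims = *[THEN graded_constructible_pure, THEN pure_of_card_complex_dim]
    have "a = Suc c" "b = Suc c" using union.hyps dims by auto
    then show ?case using * graded_constructible.union \<open>A \<union> B = L\<close> by blast
  qed
next
  assume "\<exists>d. graded_constructible d K"
  then obtain d where "graded_constructible d K" ..
  then show "constructible K"
  proof (induction rule: graded_constructible.induct)
    case (simplex F)
    then show ?case by (rule constructible.simplex)
  next
    case (union d A B)
    have gc: "graded_constructible (Suc d) (A \<union> B)"
      using union.hyps by (rule graded_constructible.union)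
    note dims = union.hyps[THEN graded_constructible_pure, THEN pure_of_card_complex_dim]
      gc[THEN graded_constructible_pure, THEN pure_of_card_complex_dim]
    show ?case
    proof (rule constructible.union[of "A \<union> B" A B])
      show "simplicial_complex (A \<union> B)" using gc by (rule graded_constructible_complex)
      show "pure (A \<union> B)" using gc[THEN graded_constructible_pure] by (rule pure_of_card_pure)
      show "subcomplex A (A \<union> B)" "subcomplex B (A \<union> B)"
        using union.hyps(1,2)[THEN graded_constructible_complex] by (simp_all add: subcomplex_def)
    qed (use union.IH dims in simp_all)
  qed
qed

text \<open>An injective renaming of vertices commutes with intersections of complexes, so it
  carries a decomposition along. It serves to rename \<open>v''\<close> back to
  \<open>v\<close>.\<close>

lemma graded_constructible_image:
  assumes "graded_constructible d K" and "inj f"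
  shows "graded_constructible d (image f ` K)"
  using assms(1)
proof (induction rule: graded_constructible.induct)
  case (simplex F)
  then show ?case
    using graded_constructible.simplex[of "f ` F"] \<open>inj f\<close>
    by (simp add: image_Pow_surj[OF refl] card_image inj_on_subset)
next
  case (union d A B)
  have "image f ` (A \<inter> B) = image f ` A \<inter> image f ` B"
    using \<open>inj f\<close> by (intro image_Int) (simp add: inj_def inj_image_eq_iff)
  then show ?case using union.IH by (simp add: image_Un graded_constructible.union)
qed

section \<open>Links in constructible complexes\<close>

lemma link_alt:
  assumes "simplicial_complex K"
  shows "link K v = {F. v \<notin> F \<and> insert v F \<in> K}"
  using simplicial_complex_mono[OF assms _ subset_insertI] unfolding link_def by auto

text \<open>Taking the link of \<open>v\<close> commutes with unions and intersections, so a
  decomposition of \<open>K\<close> induces one of the link, with every index lowered by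
  one.\<close>

lemma graded_constructible_link:
  assumes "graded_constructible d K" and "v \<in> vertices K"
  shows "\<exists>e. d = Suc e \<and> graded_constructible e (link K v)"
  using assms
proof (induction rule: graded_constructible.induct)
  case (simplex F)
  then have "v \<in> F" by (simp add: vertices_def)
  then have "link (Pow F) v = Pow (F - {v})" by (auto simp: link_def)
  then show ?case
    using graded_constructible.simplex[of "F - {v}"] simplex \<open>v \<in> F\<close>
    by (metis card.remove finite_Diff)
next
  case (union d A B)
  note cplx = union.hyps[THEN graded_constructible_complex]
  have link_Un: "link (A \<union> B) v = link A v \<union> link B v"
    using cplx by (auto simp: link_alt simplicial_complex_Un)
  have link_Int: "link (A \<inter> B) v = link A v \<inter> link B v"
    using cplx by (auto simp: link_alt)
  \<comment> \<open>The link of a non-vertex is the empty family rather than \<open>{{}}\<close>, so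
    it vanishes from the union.\<close>
  have empty: "link C v = {}" if "v \<notin> vertices C" "simplicial_complex C" for C
    using that simplicial_complex_mono[of C _ "{v}"] by (auto simp: link_def vertices_def)
  consider "v \<notin> vertices A" "v \<in> vertices B" | "v \<in> vertices A" "v \<notin> vertices B"
    | "v \<in> vertices A" "v \<in> vertices B" "v \<in> vertices (A \<inter> B)"
    using union.prems by (auto simp: vertices_def)
  then show ?case
  proof cases
    case 1
    then show ?thesis using union.IH(2) empty cplx by (simp add: link_Un)
  next
    case 2
    then show ?thesis using union.IH(1) empty cplx by (simp add: link_Un)
  next
    case 3
    \<comment> \<open>The intersection also contains \<open>{v}\<close>, so its index
      \<open>d\<close> is positive. This gives the links of \<open>A\<close> and \<open>B\<close> an
      index of the form \<open>Suc e\<close>, as the \<open>union\<close> rule requires.\<close>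
    then obtain e where "d = Suc e" "graded_constructible e (link (A \<inter> B) v)"
      using union.IH(3) by blast
    then show ?thesis
      using union.IH(1,2) 3 by (auto simp: link_Un link_Int intro: graded_constructible.union)
  qed
qed

section \<open>One-point suspensions\<close>

lemma vertices_face:
  "\<lbrakk>simplicial_complex K; w \<notin> vertices K; F \<in> K\<rbrakk> \<Longrightarrow> w \<notin> F"
  using simplicial_complex_mono[of K F "{w}"] by (auto simp: vertices_def)

text \<open>As \<open>v'\<close> and \<open>v''\<close> are new, a face splits uniquely into its
  part in \<open>{v', v''}\<close> and its part in \<open>K\<close>. Removing the join with the open
  star leaves the faces without \<open>v\<close>, and only the full edge \<open>{v', v''}\<close>
  imposes the link condition. In this form the dependence on \<open>K\<close> is through membership
  alone.\<close>

lemma one_point_suspension_alt: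
  assumes "simplicial_complex K" and "v' \<notin> vertices K" and "v'' \<notin> vertices K"
    and "v' \<noteq> v''" and "v \<noteq> v'" and "v \<noteq> v''"
  shows "one_point_suspension v' v'' v K =
    {X. v \<notin> X \<and> X - {v', v''} \<in> K \<and>
      (v' \<in> X \<longrightarrow> v'' \<in> X \<longrightarrow> insert v (X - {v', v''}) \<in> K)}" (is "_ = ?R")
proof
  note new = vertices_face[OF assms(1,2)] vertices_face[OF assms(1,3)]
  have diff: "(E \<union> F) - {v', v''} = F" if "E \<subseteq> {v', v''}" "F \<in> K" for E F
    using that new by blast
  show "one_point_suspension v' v'' v K \<subseteq> ?R"
  proof
    fix X assume "X \<in> one_point_suspension v' v'' v K"
    then consider E F where "X = E \<union> F" "E \<in> edge_boundary v' v''" "F \<in> K" "v \<notin> F"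
      | E F where "X = E \<union> F" "E \<subseteq> {v', v''}" "F \<in> link K v"
      unfolding one_point_suspension_def join_def star_def edge_def by auto
    then show "X \<in> ?R"
    proof cases
      case 1
      then have "E \<subseteq> {v', v''}" by (auto simp: edge_boundary_def)
      moreover have "\<not> (v' \<in> X \<and> v'' \<in> X)"
        using 1 new assms by (auto simp: edge_boundary_def)
      ultimately show ?thesis using 1 diff assms(5,6) by auto
    next
      case 2
      then show ?thesis using diff[of E F] assms(5,6) by (auto simp: link_def)
    qed
  qed
  show "?R \<subseteq> one_point_suspension v' v'' v K"
  proof
    fix X assume X: "X \<in> ?R"
    let ?E = "X \<inter> {v', v''}" and ?F = "X - {v', v''}"
    have split: "X = ?E \<union> ?F" by blast
    show "X \<in> one_point_suspension v' v'' v K"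
    proof (cases "v' \<in> X \<and> v'' \<in> X")
      case True
      then have "?F \<in> link K v" using X by (auto simp: link_def)
      then have "X \<in> join (edge v' v'') (link K v)"
        unfolding join_def edge_def using split by blast
      then show ?thesis by (simp add: one_point_suspension_def)
    next
      case False
      then have "?E \<in> edge_boundary v' v''" by (auto simp: edge_boundary_def)
      then have "X \<in> join (edge_boundary v' v'') K"
        unfolding join_def using split X by blast
      moreover have "X \<notin> join (edge_boundary v' v'') (star K v)"
        using X by (auto simp: join_def star_def)
      ultimately show ?thesis by (simp add: one_point_suspension_def)
    qed
  qed
qed

lemma graded_constructible_one_point_suspension:
  assumes "graded_constructible d K" and "v' \<notin> vertices K" and "v'' \<notin> vertices K"
    and "v' \<noteq> v''" and "v \<noteq> v'" and "v \<noteq> v''"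
  shows "graded_constructible (Suc d) (one_point_suspension v' v'' v K)"
  using assms(1,2,3)
proof (induction rule: graded_constructible.induct)
  case (simplex F)
  then have new: "v' \<notin> F" "v'' \<notin> F" by (auto simp: vertices_def)
  note alt = one_point_suspension_alt[OF simplicial_complex_Pow[OF simplex.hyps]
      simplex.prems assms(4-6)]
  show ?case
  proof (cases "v \<in> F")
    case True
    \<comment> \<open>The edge from \<open>v'\<close> to \<open>v''\<close> takes the place of the
      vertex \<open>v\<close> of the simplex.\<close>
    let ?G = "insert v' (insert v'' (F - {v}))"
    have "one_point_suspension v' v'' v (Pow F) = Pow ?G"
      unfolding alt using True new assms(4-6) by auto
    moreover have "card ?G = Suc (card F)"
      using True new assms(4) simplex.hyps card.remove[of F v] by simp
    ultimately show ?thesis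
      using graded_constructible.simplex[of ?G] simplex.hyps by simp
  next
    case False
    \<comment> \<open>Here the link of \<open>v\<close> is empty, so the suspension consists of the
      two cones over \<open>F\<close> with apexes \<open>v'\<close> and \<open>v''\<close>.\<close>
    have "one_point_suspension v' v'' v (Pow F) = Pow (insert v' F) \<union> Pow (insert v'' F)"
      unfolding alt using False new assms(4-6) by auto
    moreover have "Pow (insert v' F) \<inter> Pow (insert v'' F) = Pow F"
      using assms(4) new by blast
    moreover have "graded_constructible (Suc (card F)) (Pow (insert w F))" if "w \<notin> F" for w
      using graded_constructible.simplex[of "insert w F"] simplex.hyps that by simp
    ultimately show ?thesis
      using graded_constructible.union graded_constructible.simplex[OF simplex.hyps] new by metis
  qed
next
  case (union d A B)
  note cplx = union.hyps[THEN graded_constructible_complex]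
  have new: "v' \<notin> vertices A" "v'' \<notin> vertices A" "v' \<notin> vertices B" "v'' \<notin> vertices B"
    "v' \<notin> vertices (A \<inter> B)" "v'' \<notin> vertices (A \<inter> B)"
    using union.prems by (auto simp: vertices_def)
  note alts = one_point_suspension_alt[OF cplx(1) new(1,2) assms(4-6)]
    one_point_suspension_alt[OF cplx(2) new(3,4) assms(4-6)]
    one_point_suspension_alt[OF cplx(3) new(5,6) assms(4-6)]
    one_point_suspension_alt[OF simplicial_complex_Un[OF cplx(1,2)] union.prems assms(4-6)]
  let ?S = "one_point_suspension v' v'' v"
  have "?S (A \<inter> B) = ?S A \<inter> ?S B" unfolding alts by blast
  \<comment> \<open>The two membership conditions on a face could be met in different parts. Closure
    under subsets resolves this: the part containing \<open>insert v (X - {v', v''})\<close> also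
    contains \<open>X - {v', v''}\<close>.\<close>
  moreover have "?S (A \<union> B) = ?S A \<union> ?S B"
    unfolding alts using cplx(1,2)[THEN simplicial_complex_mono, OF _ subset_insertI] by auto
  ultimately show ?case
    using union.IH new graded_constructible.union by metis
qed

text \<open>Once \<open>v'\<close> is split off, a face of the link contains \<open>v''\<close>
  exactly where the corresponding face of \<open>K\<close> contains \<open>v\<close>. A
  transposition is used as the renaming because it is injective on the whole type.\<close>

lemma transpose_image_link_one_point_suspension:
  assumes "simplicial_complex K" and "v' \<notin> vertices K" and "v'' \<notin> vertices K"
    and "v' \<noteq> v''" and "v \<noteq> v'" and "v \<noteq> v''"
  shows "image (transpose v v'') ` link (one_point_suspension v' v'' v K) v' = K"
proof -
  let ?\<tau> = "transpose v v''"
  note alt = one_point_suspension_alt[OF assms]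
  note new = vertices_face[OF assms(1,2)] vertices_face[OF assms(1,3)]
  have link: "link (one_point_suspension v' v'' v K) v' =
      {X. v \<notin> X \<and> v' \<notin> X \<and> X - {v''} \<in> K \<and> (v'' \<in> X \<longrightarrow> insert v (X - {v''}) \<in> K)}"
  proof -
    have "X - {v', v''} = X - {v''}" "insert v' X - {v', v''} = X - {v''}" if "v' \<notin> X" for X
      using that by auto
    then show ?thesis using assms(4-6) unfolding link_def alt by auto
  qed
  have image: "?\<tau> ` X = (if v'' \<in> X then insert v (X - {v''}) else X)" if "v \<notin> X" for X
    using that by (auto simp: transpose_def image_iff)
  have in_K: "?\<tau> ` X \<in> K" if "X \<in> link (one_point_suspension v' v'' v K) v'" for X
    using that unfolding link by (cases "v'' \<in> X") (auto simp: image)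
  have in_link: "?\<tau> ` X \<in> link (one_point_suspension v' v'' v K) v'" if "X \<in> K" for X
  proof (cases "v \<in> X")
    case True
    then have "?\<tau> ` X = insert v'' (X - {v})"
      using new(2)[OF that] by (auto simp: transpose_def image_iff)
    moreover have "X - {v} \<in> K" using simplicial_complex_mono[OF assms(1) that] by blast
    ultimately show ?thesis
      using True that new[OF that] assms(4-6) unfolding link by (simp add: insert_absorb)
  next
    case False
    then show ?thesis using that new[OF that] unfolding link by (simp add: image)
  qed
  \<comment> \<open>The transposition is an involution, so mapping each family into the other
    already yields equality.\<close>
  have "X = ?\<tau> ` ?\<tau> ` X" for X by (simp add: image_image)
  then show ?thesis using in_K in_link by blast
qed

theorem proposition4p6:
  fixes K :: "'a set set" and v v' v'' :: 'a
  assumes "simplicial_complex K"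
    and "v \<in> vertices K"
    and "v' \<notin> vertices K" and "v'' \<notin> vertices K" and "v' \<noteq> v''"
  shows "constructible (one_point_suspension v' v'' v K) \<longleftrightarrow> constructible K"
proof
  have ne: "v \<noteq> v'" "v \<noteq> v''" using assms by auto
  note assms' = assms(3-5) ne
  let ?S = "one_point_suspension v' v'' v K"
  show "constructible ?S" if "constructible K"
    using that graded_constructible_one_point_suspension[OF _ assms']
    unfolding constructible_iff_graded by blast
  show "constructible K" if S: "constructible ?S"
  proof -
    obtain d where d: "graded_constructible d ?S"
      using S unfolding constructible_iff_graded by blast
    \<comment> \<open>The face \<open>{v'}\<close> comes from the empty face of
      \<open>K\<close>.\<close>
    have "v' \<in> vertices ?S"
      using assms ne unfolding vertices_def one_point_suspension_alt[OF assms(1) assms']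
      by (simp add: simplicial_complex_def)
    from graded_constructible_link[OF d this]
    obtain e where "graded_constructible e (link ?S v')" by (elim exE conjE)
    from graded_constructible_image[OF this inj_transpose[of v v'']]
    have "graded_constructible e K"
      unfolding transpose_image_link_one_point_suspension[OF assms(1) assms'] .
    then show ?thesis unfolding constructible_iff_graded ..
  qed
qed

end
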